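(* Let $\langle D,I,G\rangle$ be a planning problem, $\alpha=s_0a_1\ldots a_ns_n$ be a trajectory, and $\varphi$ be a basic desire formula. Then, for every $t$ with $0\le t\le \mathit{length}$ and every basic desire formula $\eta$ with $desire(n_\eta)\in\Pi_\varphi$, $$\alpha[t]\models\eta\quad\text{iff}\quad \Pi_\varphi\cup\Pi_{sat}\cup\alpha^{-1}\models satisfy(n_\eta,t),$$ where $\alpha[t]$ is the trajectory $s_ta_{t+1}\ldots a_ns_n$ and $\alpha^{-1}=\{occ(a_i,i-1)\mid i\in\{1,\ldots,n\}\}\cup\{holds(f,i)\mid f\in s_i,\ i\in\{0,\ldots,n\}\}$.
   Context: Setting. $\mathbf{A}$ (actions) and $\mathbf{F}$ (fluents) are disjoint sets of names. A fluent literal is $f$ or $\neg f$ with $f\in\mathbf{F}$; a fluent formula is a propositional formula built from fluent literals. An action theory is a pair $(D,I)$, where $D$ is a set of propositions giving the effects of actions, static causal laws "$f$ if $p_1,\dots,p_m$" (with fluent literals), and executability conditions of actions, and $I$ is a set of propositions $\mathbf{initially}(f)$ describing the initial state. A state $s$ is a set of fluent literals containing, for each $f\in\mathbf{F}$, exactly one of $f,\neg f$, and satisfying the static causal laws; $s\models l$ iff $l\in s$ for a fluent literal $l$, extended to fluent formulas as usual. $\Phi(a,s)$ is the set of states that may result from executing action $a$ in state $s$. Action theories are assumed consistent: $\{f\mid\mathbf{initially}(f)\in I\}$ is a state, and $\Phi(a,s)\ne\emptyset$ whenever $a$ is executable in $s$. A trajectory is a sequence $s_0a_1s_1\ldots a_ns_n$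 of states $s_i$ and actions $a_i$ with $s_{i+1}\in\Phi(a_{i+1},s_i)$ for $0\le i\le n-1$. A planning problem is a triple $\langle D,I,G\rangle$ with $(D,I)$ an action theory and $G$ a fluent formula (the goal). The parameter $\mathit{length}$ is the maximal length of a trajectory that the user can accept; time moments are the integers between $0$ and $\mathit{length}$. For a logic program $\Pi$ and ground atom $A$, $\Pi\models A$ means that $A$ belongs to every answer set (stable model) of $\Pi$. Basic desire formulas: $\mathbf{goal}(\psi)$ with $\psi$ a fluent formula; any fluent formula; $occ(a)$ with $a\in\mathbf{A}$; and, if $\varphi_1,\varphi_2$ are basic desire formulas, $\varphi_1\wedge\varphi_2$, $\varphi_1\vee\varphi_2$, $\neg\varphi_1$, $\mathbf{next}(\varphi_1)$, $\mathbf{until}(\varphi_1,\varphi_2)$, $\mathbf{always}(\varphi_1)$, $\mathbf{eventually}(\varphi_1)$. Satisfaction by $\alpha=s_0a_1s_1\ldots a_ns_n$, where $\alpha[i]$ denotes $s_ia_{i+1}s_{i+1}\ldots a_ns_n$: $\alpha\models\mathbf{goal}(\psi)$ iff $s_n\models\psi$; for a fluent formula $\psi$, $\alpha\models\psi$ iff $s_0\models\psi$; $\alpha\models occ(a)$ iff $n\ge1$ and $a_1=a$; $\wedge,\vee,\neg$ as usual; $\alpha\models\mathbf{next}(\psi)$ iff $n\ge1$ and $\alpha[1]\models\psi$; $\alpha\models\mathbf{always}(\psi)$ iff $\alpha[i]\models\psi$ for all $0\le i\le n$; $\alpha\models\mathbf{eventually}(\psi)$ iff $\alpha[i]\models\psi$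 for some $0\le i\le n$; $\alpha\models\mathbf{until}(\psi_1,\psi_2)$ iff for some $0\le i\le n$, $\alpha[i]\models\psi_2$ and $\alpha[j]\models\psi_1$ for all $0\le j<i$. Encoding $\Pi_\varphi$. Each basic desire formula $\eta$ has a unique name $n_\eta$ (a fluent literal is its own name). $\Pi_\varphi$ is a set of facts containing $desire(l)$ for every fluent literal $l$ and defined inductively: if $\varphi$ is a fluent literal $l$, $\Pi_\varphi=\{desire(l)\}$; if $\varphi=\mathbf{goal}(\phi)$, $\Pi_\varphi=\Pi_\phi\cup\{desire(n_\varphi),goal(n_\phi)\}$; if $\varphi=occ(a)$, $\Pi_\varphi=\{desire(n_\varphi),happen(n_\varphi,a)\}$; if $\varphi=\varphi_1\wedge\varphi_2$, $\Pi_\varphi=\Pi_{\varphi_1}\cup\Pi_{\varphi_2}\cup\{desire(n_\varphi),and(n_\varphi,n_{\varphi_1},n_{\varphi_2})\}$; if $\varphi=\varphi_1\vee\varphi_2$, the same with $or(n_\varphi,n_{\varphi_1},n_{\varphi_2})$ in place of the $and$ fact; if $\varphi=\neg\phi$, $\Pi_\varphi=\Pi_\phi\cup\{desire(n_\varphi),negation(n_\varphi,n_\phi)\}$; if $\varphi=\mathbf{next}(\phi)$, $\Pi_\varphi=\Pi_\phi\cup\{desire(n_\varphi),next(n_\varphi,n_\phi)\}$; if $\varphi=\mathbf{until}(\varphi_1,\varphi_2)$, $\Pi_\varphi=\Pi_{\varphi_1}\cup\Pi_{\varphi_2}\cup\{desire(n_\varphi),until(n_\varphi,n_{\varphi_1},n_{\varphi_2})\}$;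 if $\varphi=\mathbf{always}(\phi)$, $\Pi_\varphi=\Pi_\phi\cup\{desire(n_\varphi),always(n_\varphi,n_\phi)\}$; if $\varphi=\mathbf{eventually}(\phi)$, $\Pi_\varphi=\Pi_\phi\cup\{desire(n_\varphi),eventually(n_\varphi,n_\phi)\}$. Program $\Pi_{sat}$ consists of the following rules, where $T,T_1$ are variables for time moments, $F,F_1,F_2$ for names of basic desires, $A$ for actions, $literal(F)$ says that $F$ is a fluent literal, and "not" is negation as failure: $satisfy(F,T)\leftarrow desire(F),goal(F),satisfy(F,\mathit{length})$; $satisfy(F,T)\leftarrow desire(F),happen(F,A),occ(A,T)$; $satisfy(F,T)\leftarrow desire(F),literal(F),holds(F,T)$; $satisfy(F,T)\leftarrow desire(F),and(F,F_1,F_2),satisfy(F_1,T),satisfy(F_2,T)$; $satisfy(F,T)\leftarrow desire(F),or(F,F_1,F_2),satisfy(F_1,T)$; $satisfy(F,T)\leftarrow desire(F),or(F,F_1,F_2),satisfy(F_2,T)$; $satisfy(F,T)\leftarrow desire(F),negation(F,F_1),\text{not } satisfy(F_1,T)$; $satisfy(F,T)\leftarrow desire(F),until(F,F_1,F_2),T<T_1,during(F_1,T,T_1-1),satisfy(F_2,T_1)$; $satisfy(F,T)\leftarrow desire(F),until(F,F_1,F_2),satisfy(F_2,T)$; $satisfy(F,T)\leftarrow desire(F),always(F,F_1),during(F_1,T,\mathit{length})$; $satisfy(F,T)\leftarrow desire(F),next(F,F_1),satisfy(F_1,T+1)$; $satisfy(F,T)\leftarrow desire(F),eventually(F,F_1),T\le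 T_1,satisfy(F_1,T_1)$; $during(F,T,T_1)\leftarrow T<T_1,desire(F),satisfy(F,T),during(F,T+1,T_1)$; $during(F,T,T)\leftarrow desire(F),satisfy(F,T)$.
   Formalization: The goal fact is made binary, goal(n_{goal(ψ)}, n_ψ), with rule satisfy(F,T) ← desire(F), goal(F,F1), satisfy(F1,length), as the printed unary version makes the claim false; the trajectory is taken to have exactly n = length steps, since α[t] is undefined for t > n. *)

theory Defs
  imports Main
begin

section \<open>Action theories\<close>

datatype 'f literal = Pos 'f | Neg 'f

type_synonym 'f state = "'f literal set"

text \<open>
  Action names and fluent names live in two distinct types, hence are disjoint.
  \<open>Causes a l ps\<close> is ``a causes l if ps'', \<open>Caused l ps\<close> is the static causal law ``l if ps'',
  \<open>Executable a ps\<close> is ``a executable if ps''.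
\<close>

datatype ('a, 'f) domain_prop =
    Causes 'a "'f literal" "'f literal list"
  | Caused "'f literal" "'f literal list"
  | Executable 'a "'f literal list"

datatype 'f init_prop = Initially "'f literal"

definition closed_under_laws :: "('a, 'f) domain_prop set \<Rightarrow> 'f literal set \<Rightarrow> bool" where
  "closed_under_laws D X \<longleftrightarrow> (\<forall>l ps. Caused l ps \<in> D \<longrightarrow> set ps \<subseteq> X \<longrightarrow> l \<in> X)"

definition is_state :: "('a, 'f) domain_prop set \<Rightarrow> 'f state \<Rightarrow> bool" where
  "is_state D s \<longleftrightarrow> (\<forall>f. (Pos f \<in> s) \<noteq> (Neg f \<in> s)) \<and> closed_under_laws D s"

definition Cl :: "('a, 'f) domain_prop set \<Rightarrow> 'f literal set \<Rightarrow> 'f literal set" where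
  "Cl D X = \<Inter>{Y. X \<subseteq> Y \<and> closed_under_laws D Y}"

definition executable_in :: "('a, 'f) domain_prop set \<Rightarrow> 'a \<Rightarrow> 'f state \<Rightarrow> bool" where
  "executable_in D a s \<longleftrightarrow> (\<exists>ps. Executable a ps \<in> D \<and> set ps \<subseteq> s)"

definition direct_effects :: "('a, 'f) domain_prop set \<Rightarrow> 'a \<Rightarrow> 'f state \<Rightarrow> 'f literal set" where
  "direct_effects D a s = {l. \<exists>ps. Causes a l ps \<in> D \<and> set ps \<subseteq> s}"

text \<open>
  The transition function of the action language B (Gelfond and Lifschitz): a successor state
  is exactly what follows from the direct effects and inertia under the static causal laws.
\<close>

definition Phi :: "('a, 'f) domain_prop set \<Rightarrow> 'a \<Rightarrow> 'f state \<Rightarrow> 'f state set" where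
  "Phi D a s =
     (if executable_in D a s
      then {s'. is_state D s' \<and> s' = Cl D (direct_effects D a s \<union> (s \<inter> s'))}
      else {})"

definition consistent_theory ::
    "('a, 'f) domain_prop set \<Rightarrow> 'f init_prop set \<Rightarrow> bool" where
  "consistent_theory D I \<longleftrightarrow>
     is_state D {l. Initially l \<in> I} \<and>
     (\<forall>a s. is_state D s \<longrightarrow> executable_in D a s \<longrightarrow> Phi D a s \<noteq> {})"


section \<open>Fluent formulas, planning problems, trajectories\<close>

datatype 'f fformula =
    FLit "'f literal"
  | FAnd "'f fformula" "'f fformula"
  | FOr "'f fformula" "'f fformula"
  | FNot "'f fformula"

primrec state_sat :: "'f state \<Rightarrow> 'f fformula \<Rightarrow> bool" where
  "state_sat s (FLit l) \<longleftrightarrow> l \<in> s"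
| "state_sat s (FAnd p q) \<longleftrightarrow> state_sat s p \<and> state_sat s q"
| "state_sat s (FOr p q) \<longleftrightarrow> state_sat s p \<or> state_sat s q"
| "state_sat s (FNot p) \<longleftrightarrow> \<not> state_sat s p"

text \<open>The goal may be any fluent formula, so only the action theory is constrained.\<close>

definition planning_problem ::
    "('a, 'f) domain_prop set \<times> 'f init_prop set \<times> 'f fformula \<Rightarrow> bool" where
  "planning_problem = (\<lambda>(D, I, G). consistent_theory D I)"

text \<open>
  The sequence \<open>s\<^sub>0 a\<^sub>1 s\<^sub>1 \<dots> a\<^sub>n s\<^sub>n\<close> is represented by the pair of lists
  \<open>([s\<^sub>0, \<dots>, s\<^sub>n], [a\<^sub>1, \<dots>, a\<^sub>n])\<close>.
\<close>

type_synonym ('a, 'f) trajectory = "'f state list \<times> 'a list"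

definition traj_length :: "('a, 'f) trajectory \<Rightarrow> nat" where
  "traj_length \<alpha> = length (snd \<alpha>)"

definition traj_state :: "('a, 'f) trajectory \<Rightarrow> nat \<Rightarrow> 'f state" where
  "traj_state \<alpha> i = fst \<alpha> ! i"

text \<open>Actions are numbered from 1: \<open>traj_action \<alpha> i\<close> is \<open>a\<^sub>i\<close> for \<open>1 \<le> i \<le> n\<close>.\<close>

definition traj_action :: "('a, 'f) trajectory \<Rightarrow> nat \<Rightarrow> 'a" where
  "traj_action \<alpha> i = snd \<alpha> ! (i - 1)"

definition is_trajectory :: "('a, 'f) domain_prop set \<Rightarrow> ('a, 'f) trajectory \<Rightarrow> bool" where
  "is_trajectory D \<alpha> \<longleftrightarrow>
     length (fst \<alpha>) = traj_length \<alpha> + 1 \<and>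
     (\<forall>i \<le> traj_length \<alpha>. is_state D (traj_state \<alpha> i)) \<and>
     (\<forall>i < traj_length \<alpha>. traj_state \<alpha> (i + 1) \<in> Phi D (traj_action \<alpha> (i + 1)) (traj_state \<alpha> i))"

text \<open>\<open>\<alpha>[i]\<close>, meaningful for \<open>i \<le> n\<close>.\<close>

definition traj_from :: "('a, 'f) trajectory \<Rightarrow> nat \<Rightarrow> ('a, 'f) trajectory" where
  "traj_from \<alpha> i = (drop i (fst \<alpha>), drop i (snd \<alpha>))"


section \<open>Basic desire formulas\<close>

text \<open>
  The fluent formulas among the basic desire formulas are those in the range of \<open>of_fformula\<close>
  below. Sharing the connectives ensures that a fluent formula such as
  \<open>f \<and> g\<close> is a single basic desire formula and so has a single name. The literal \<open>\<not>f\<close> is \<open>Lit (Neg f)\<close>;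
  \<open>DNot (Lit (Pos f))\<close> is also available as a (compound) formula, with its own name.
\<close>

datatype ('a, 'f) basic_desire =
    Goal "'f fformula"
  | Lit "'f literal"
  | Occ 'a
  | DAnd "('a, 'f) basic_desire" "('a, 'f) basic_desire"
  | DOr "('a, 'f) basic_desire" "('a, 'f) basic_desire"
  | DNot "('a, 'f) basic_desire"
  | Next "('a, 'f) basic_desire"
  | Until "('a, 'f) basic_desire" "('a, 'f) basic_desire"
  | Always "('a, 'f) basic_desire"
  | Eventually "('a, 'f) basic_desire"

primrec of_fformula :: "'f fformula \<Rightarrow> ('a, 'f) basic_desire" where
  "of_fformula (FLit l) = Lit l"
| "of_fformula (FAnd p q) = DAnd (of_fformula p) (of_fformula q)"
| "of_fformula (FOr p q) = DOr (of_fformula p) (of_fformula q)"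
| "of_fformula (FNot p) = DNot (of_fformula p)"

primrec sat :: "('a, 'f) trajectory \<Rightarrow> ('a, 'f) basic_desire \<Rightarrow> bool" where
  "sat \<alpha> (Goal p) \<longleftrightarrow> state_sat (traj_state \<alpha> (traj_length \<alpha>)) p"
| "sat \<alpha> (Lit l) \<longleftrightarrow> l \<in> traj_state \<alpha> 0"
| "sat \<alpha> (Occ a) \<longleftrightarrow> traj_length \<alpha> \<ge> 1 \<and> traj_action \<alpha> 1 = a"
| "sat \<alpha> (DAnd p q) \<longleftrightarrow> sat \<alpha> p \<and> sat \<alpha> q"
| "sat \<alpha> (DOr p q) \<longleftrightarrow> sat \<alpha> p \<or> sat \<alpha> q"
| "sat \<alpha> (DNot p) \<longleftrightarrow> \<not> sat \<alpha> p"
| "sat \<alpha> (Next p) \<longleftrightarrow> traj_length \<alpha> \<ge> 1 \<and> sat (traj_from \<alpha> 1) p"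
| "sat \<alpha> (Until p q) \<longleftrightarrow>
     (\<exists>i \<le> traj_length \<alpha>. sat (traj_from \<alpha> i) q \<and> (\<forall>j < i. sat (traj_from \<alpha> j) p))"
| "sat \<alpha> (Always p) \<longleftrightarrow> (\<forall>i \<le> traj_length \<alpha>. sat (traj_from \<alpha> i) p)"
| "sat \<alpha> (Eventually p) \<longleftrightarrow> (\<exists>i \<le> traj_length \<alpha>. sat (traj_from \<alpha> i) p)"

lemma sat_of_fformula: "sat \<alpha> (of_fformula p) \<longleftrightarrow> state_sat (traj_state \<alpha> 0) p"
  by (induction p) auto


section \<open>Ground normal logic programs and answer sets\<close>

text \<open>\<open>Rule h [b\<^sub>1, \<dots>] [c\<^sub>1, \<dots>]\<close> is \<open>h \<leftarrow> b\<^sub>1, \<dots>, not c\<^sub>1, \<dots>\<close>.\<close>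

datatype 'x rule = Rule (head: 'x) (pos_body: "'x list") (neg_body: "'x list")

definition facts :: "'x set \<Rightarrow> 'x rule set" where
  "facts A = {Rule h [] [] | h. h \<in> A}"

definition reduct :: "'x rule set \<Rightarrow> 'x set \<Rightarrow> 'x rule set" where
  "reduct P M = {Rule (head r) (pos_body r) [] | r. r \<in> P \<and> set (neg_body r) \<inter> M = {}}"

text \<open>Used only for programs without negation as failure.\<close>

definition least_model :: "'x rule set \<Rightarrow> 'x set" where
  "least_model P = \<Inter>{X. \<forall>r \<in> P. set (pos_body r) \<subseteq> X \<longrightarrow> head r \<in> X}"

definition answer_set :: "'x rule set \<Rightarrow> 'x set \<Rightarrow> bool" where
  "answer_set P M \<longleftrightarrow> M = least_model (reduct P M)"

definition entails :: "'x rule set \<Rightarrow> 'x \<Rightarrow> bool" where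
  "entails P A \<longleftrightarrow> (\<forall>M. answer_set P M \<longrightarrow> A \<in> M)"


section \<open>The encoding of basic desire formulas\<close>

text \<open>Terms denoting basic desires: a fluent literal is its own name.\<close>

datatype ('f, 'n) name = LitName "'f literal" | Name 'n

definition naming :: "(('a, 'f) basic_desire \<Rightarrow> ('f, 'n) name) \<Rightarrow> bool" where
  "naming nm \<longleftrightarrow> inj nm \<and> (\<forall>l. nm (Lit l) = LitName l)"

datatype ('a, 'f, 'n) atom =
    desire "('f, 'n) name"
  | goal "('f, 'n) name" "('f, 'n) name"
  | happen "('f, 'n) name" 'a
  | and_f "('f, 'n) name" "('f, 'n) name" "('f, 'n) name"
  | or_f "('f, 'n) name" "('f, 'n) name" "('f, 'n) name"
  | negation_f "('f, 'n) name" "('f, 'n) name"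
  | next_f "('f, 'n) name" "('f, 'n) name"
  | until_f "('f, 'n) name" "('f, 'n) name" "('f, 'n) name"
  | always_f "('f, 'n) name" "('f, 'n) name"
  | eventually_f "('f, 'n) name" "('f, 'n) name"
  | occ 'a nat
  | holds "('f, 'n) name" nat
  | satisfy "('f, 'n) name" nat
  | during "('f, 'n) name" nat nat

lemma size_of_fformula: "size (of_fformula p :: ('a, 'f) basic_desire) = size p"
  by (induction p) auto

text \<open>
  The predicate \<open>goal\<close> is binary and links the name of \<open>Goal p\<close> to the name of \<open>p\<close>, like
  \<open>negation_f\<close> and \<open>next_f\<close>. A unary fact \<open>goal(n\<^sub>p)\<close> together with the rule
  \<open>satisfy(F,T) \<leftarrow> desire(F), goal(F), satisfy(F,length)\<close> would leave
  the name of \<open>Goal p\<close> without an applicable rule, and would make \<open>p\<close> itself satisfied at all times once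
  it is satisfied at the end.
\<close>

function encoding ::
    "(('a, 'f) basic_desire \<Rightarrow> ('f, 'n) name) \<Rightarrow> ('a, 'f) basic_desire \<Rightarrow> ('a, 'f, 'n) atom set" where
  "encoding nm (Lit l) = {desire (nm (Lit l))}"
| "encoding nm (Goal p) =
     encoding nm (of_fformula p) \<union> {desire (nm (Goal p)), goal (nm (Goal p)) (nm (of_fformula p))}"
| "encoding nm (Occ a) = {desire (nm (Occ a)), happen (nm (Occ a)) a}"
| "encoding nm (DAnd p q) =
     encoding nm p \<union> encoding nm q \<union>
     {desire (nm (DAnd p q)), and_f (nm (DAnd p q)) (nm p) (nm q)}"
| "encoding nm (DOr p q) =
     encoding nm p \<union> encoding nm q \<union>
     {desire (nm (DOr p q)), or_f (nm (DOr p q)) (nm p) (nm q)}"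
| "encoding nm (DNot p) =
     encoding nm p \<union> {desire (nm (DNot p)), negation_f (nm (DNot p)) (nm p)}"
| "encoding nm (Next p) =
     encoding nm p \<union> {desire (nm (Next p)), next_f (nm (Next p)) (nm p)}"
| "encoding nm (Until p q) =
     encoding nm p \<union> encoding nm q \<union>
     {desire (nm (Until p q)), until_f (nm (Until p q)) (nm p) (nm q)}"
| "encoding nm (Always p) =
     encoding nm p \<union> {desire (nm (Always p)), always_f (nm (Always p)) (nm p)}"
| "encoding nm (Eventually p) =
     encoding nm p \<union> {desire (nm (Eventually p)), eventually_f (nm (Eventually p)) (nm p)}"
  by pat_completeness auto
termination
  by (relation "measure (\<lambda>(nm, p). size p)") (auto simp: size_of_fformula)

definition Pi_desire ::
    "(('a, 'f) basic_desire \<Rightarrow> ('f, 'n) name) \<Rightarrow> ('a, 'f) basic_desire \<Rightarrow> ('a, 'f, 'n) atom set" where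
  "Pi_desire nm \<phi> = {desire (nm (Lit l)) | l. True} \<union> encoding nm \<phi>"

text \<open>
  The ground instances of the rules for \<open>satisfy\<close> and \<open>during\<close>; \<open>T\<close> and \<open>T1\<close> range over the time
  moments \<open>0, \<dots>, len\<close>. The comparisons of time moments and the test \<open>literal(F)\<close> are evaluated
  during grounding. At \<open>T = len\<close> the body of the rule for \<open>next_f\<close> mentions \<open>T + 1\<close>, which is not a
  time moment; no rule has an atom \<open>satisfy F (len + 1)\<close> in its head, so that instance is inert.
\<close>

inductive_set Pi_sat :: "nat \<Rightarrow> ('a, 'f, 'n) atom rule set" for len :: nat where
  "T \<le> len \<Longrightarrow>
    Rule (satisfy F T) [desire F, goal F F1, satisfy F1 len] [] \<in> Pi_sat len"
| "T \<le> len \<Longrightarrow>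
    Rule (satisfy F T) [desire F, happen F A, occ A T] [] \<in> Pi_sat len"
| "T \<le> len \<Longrightarrow> F = LitName l \<Longrightarrow>
    Rule (satisfy F T) [desire F, holds F T] [] \<in> Pi_sat len"
| "T \<le> len \<Longrightarrow>
    Rule (satisfy F T) [desire F, and_f F F1 F2, satisfy F1 T, satisfy F2 T] [] \<in> Pi_sat len"
| "T \<le> len \<Longrightarrow>
    Rule (satisfy F T) [desire F, or_f F F1 F2, satisfy F1 T] [] \<in> Pi_sat len"
| "T \<le> len \<Longrightarrow>
    Rule (satisfy F T) [desire F, or_f F F1 F2, satisfy F2 T] [] \<in> Pi_sat len"
| "T \<le> len \<Longrightarrow>
    Rule (satisfy F T) [desire F, negation_f F F1] [satisfy F1 T] \<in> Pi_sat len"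
| "T \<le> len \<Longrightarrow> T1 \<le> len \<Longrightarrow> T < T1 \<Longrightarrow>
    Rule (satisfy F T) [desire F, until_f F F1 F2, during F1 T (T1 - 1), satisfy F2 T1] []
      \<in> Pi_sat len"
| "T \<le> len \<Longrightarrow>
    Rule (satisfy F T) [desire F, until_f F F1 F2, satisfy F2 T] [] \<in> Pi_sat len"
| "T \<le> len \<Longrightarrow>
    Rule (satisfy F T) [desire F, always_f F F1, during F1 T len] [] \<in> Pi_sat len"
| "T \<le> len \<Longrightarrow>
    Rule (satisfy F T) [desire F, next_f F F1, satisfy F1 (T + 1)] [] \<in> Pi_sat len"
| "T \<le> len \<Longrightarrow> T1 \<le> len \<Longrightarrow> T \<le> T1 \<Longrightarrow>
    Rule (satisfy F T) [desire F, eventually_f F F1, satisfy F1 T1] [] \<in> Pi_sat len"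
| "T \<le> len \<Longrightarrow> T1 \<le> len \<Longrightarrow> T < T1 \<Longrightarrow>
    Rule (during F T T1) [desire F, satisfy F T, during F (T + 1) T1] [] \<in> Pi_sat len"
| "T \<le> len \<Longrightarrow>
    Rule (during F T T) [desire F, satisfy F T] [] \<in> Pi_sat len"

definition traj_facts :: "('a, 'f) trajectory \<Rightarrow> ('a, 'f, 'n) atom set" where
  "traj_facts \<alpha> =
     {occ (traj_action \<alpha> i) (i - 1) | i. i \<in> {1..traj_length \<alpha>}} \<union>
     {holds (LitName l) i | l i. l \<in> traj_state \<alpha> i \<and> i \<in> {0..traj_length \<alpha>}}"

end

theory Submission
  imports Defs
begin

text \<open>
  Negation as failure only refers to \<open>satisfy\<close> atoms of strictly smaller formulas. Hence, if a set
  \<open>M\<close> of atoms is right about all formulas smaller than \<open>\<eta>\<close>, the least model of the reduct by \<open>M\<close>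
  is right about \<open>\<eta>\<close>, since its atoms satisfy the completion of the program. For an answer set \<open>M\<close>
  this is the step of an induction on \<open>\<eta>\<close>. Applied to the set of all true \<open>satisfy\<close> atoms, it also
  yields an answer set, without which entailment would be vacuous.
\<close>

section \<open>Least models and reducts\<close>

lemma least_model_closed:
  assumes "r \<in> P" "set (pos_body r) \<subseteq> least_model P"
  shows "head r \<in> least_model P"
  using assms unfolding least_model_def by blast

lemma least_model_least:
  assumes "\<And>r. r \<in> P \<Longrightarrow> set (pos_body r) \<subseteq> X \<Longrightarrow> head r \<in> X"
  shows "least_model P \<subseteq> X"
  unfolding least_model_def using assms by (intro Inter_lower) blast

text \<open>If no rule for \<open>x\<close> had its body in the least model, removing
  \<open>x\<close> would leave a smaller set still closed under all rules.\<close>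

lemma least_model_supported:
  assumes "x \<in> least_model P"
  shows "\<exists>r \<in> P. head r = x \<and> set (pos_body r) \<subseteq> least_model P"
proof (rule ccontr)
  assume unsupported: "\<not> ?thesis"
  have "least_model P \<subseteq> least_model P - {x}"
  proof (rule least_model_least)
    fix r
    assume "r \<in> P" "set (pos_body r) \<subseteq> least_model P - {x}"
    then show "head r \<in> least_model P - {x}"
      using unsupported least_model_closed by blast
  qed
  with assms show False by blast
qed

lemma reduct_iff: "Rule x bs ds \<in> reduct P M \<longleftrightarrow> ds = [] \<and> (\<exists>cs. Rule x bs cs \<in> P \<and> set cs \<inter> M = {})"
proof
  assume "Rule x bs ds \<in> reduct P M"
  then obtain r where "r \<in> P" "ds = []" "x = head r" "bs = pos_body r" "set (neg_body r) \<inter> M = {}"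
    by (auto simp: reduct_def)
  then show "ds = [] \<and> (\<exists>cs. Rule x bs cs \<in> P \<and> set cs \<inter> M = {})"
    by (metis rule.collapse)
next
  assume "ds = [] \<and> (\<exists>cs. Rule x bs cs \<in> P \<and> set cs \<inter> M = {})"
  then obtain cs where "ds = []" "Rule x bs cs \<in> P" "set cs \<inter> M = {}"
    by blast
  then show "Rule x bs ds \<in> reduct P M"
    unfolding reduct_def by (intro CollectI exI[of _ "Rule x bs cs"]) simp
qed

lemma least_model_iff:
  "x \<in> least_model P \<longleftrightarrow> (\<exists>bs ds. Rule x bs ds \<in> P \<and> set bs \<subseteq> least_model P)"
proof
  assume "x \<in> least_model P"
  then obtain r where "r \<in> P" "head r = x" "set (pos_body r) \<subseteq> least_model P"
    using least_model_supported[of x P] by blast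
  then show "\<exists>bs ds. Rule x bs ds \<in> P \<and> set bs \<subseteq> least_model P"
    by (metis rule.collapse)
next
  assume "\<exists>bs ds. Rule x bs ds \<in> P \<and> set bs \<subseteq> least_model P"
  then obtain bs ds where "Rule x bs ds \<in> P" "set bs \<subseteq> least_model P"
    by blast
  then show "x \<in> least_model P"
    using least_model_closed[of "Rule x bs ds" P] by simp
qed

text \<open>Closedness and support together give the completion of the program. Positive bodies are
  read in the least model, negated ones in \<open>M\<close>; the two sets need not coincide.\<close>

lemma least_model_reduct_iff:
  "x \<in> least_model (reduct P M) \<longleftrightarrow>
     (\<exists>bs cs. Rule x bs cs \<in> P \<and> set bs \<subseteq> least_model (reduct P M) \<and> set cs \<inter> M = {})"
  by (subst least_model_iff) (auto simp: reduct_iff)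

section \<open>Suffixes of trajectories and shifts of time\<close>

lemma traj_length_traj_from: "traj_length (traj_from \<alpha> i) = traj_length \<alpha> - i"
  by (simp add: traj_length_def traj_from_def)

lemma traj_from_traj_from: "traj_from (traj_from \<alpha> i) j = traj_from \<alpha> (i + j)"
  by (simp add: traj_from_def add.commute)

text \<open>Satisfaction on a suffix quantifies over offsets from \<open>t\<close>, the rules over
  absolute time moments; \<open>all_le_diff_iff\<close> makes the same translation.\<close>

lemma ex_le_diff_iff:
  fixes t n :: nat
  assumes "t \<le> n"
  shows "(\<exists>i \<le> n - t. P (t + i)) \<longleftrightarrow> (\<exists>u. t \<le> u \<and> u \<le> n \<and> P u)"
  by (metis assms le_add1 le_add_diff_inverse nat_add_left_cancel_le)

lemma all_le_diff_iff:
  fixes t n :: nat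
  assumes "t \<le> n"
  shows "(\<forall>i \<le> n - t. P (t + i)) \<longleftrightarrow> (\<forall>u. t \<le> u \<longrightarrow> u \<le> n \<longrightarrow> P u)"
  by (metis assms le_add1 le_add_diff_inverse nat_add_left_cancel_le)

text \<open>Mirrors the two rules for \<open>until_f\<close>, one of which handles the first moment
  alone.\<close>

lemma ex_le_split_first:
  fixes t n :: nat
  assumes "t \<le> n"
  shows "(\<exists>u. t \<le> u \<and> u \<le> n \<and> P u) \<longleftrightarrow> P t \<or> (\<exists>u. t < u \<and> u \<le> n \<and> P u)"
  using assms by (metis le_refl nat_less_le)

lemma all_less_shift_iff:
  fixes t i :: nat
  shows "(\<forall>j < i. P (t + j)) \<longleftrightarrow> (\<forall>u. t \<le> u \<longrightarrow> u < t + i \<longrightarrow> P u)"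
  by (metis le_add1 le_add_diff_inverse nat_add_left_cancel_less)

section \<open>Structure of the encoding\<close>

lemma desire_in_encoding: "desire (nm \<eta>) \<in> encoding nm \<eta>"
  by (cases \<eta>) auto

text \<open>As \<open>nm\<close> is injective, the fact \<open>desire (nm \<eta>)\<close> can only
  arise where the recursion meets \<eta> itself, and there the whole encoding of \<eta> is
  included.\<close>

lemma encoding_mono:
  assumes "inj nm"
  shows "desire (nm \<eta>) \<in> encoding nm \<phi> \<Longrightarrow> encoding nm \<eta> \<subseteq> encoding nm \<phi>"
  using assms by (induction nm \<phi> rule: encoding.induct) (force simp: inj_eq)+

lemma encoding_shape:
  "desire F \<in> encoding nm \<phi> \<Longrightarrow> \<exists>p. F = nm p"
  "goal F F1 \<in> encoding nm \<phi> \<Longrightarrow> \<exists>p. F = nm (Goal p) \<and> F1 = nm (of_fformula p)"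
  "happen F a \<in> encoding nm \<phi> \<Longrightarrow> F = nm (Occ a)"
  "and_f F F1 F2 \<in> encoding nm \<phi> \<Longrightarrow> \<exists>p q. F = nm (DAnd p q) \<and> F1 = nm p \<and> F2 = nm q"
  "or_f F F1 F2 \<in> encoding nm \<phi> \<Longrightarrow> \<exists>p q. F = nm (DOr p q) \<and> F1 = nm p \<and> F2 = nm q"
  "negation_f F F1 \<in> encoding nm \<phi> \<Longrightarrow> \<exists>p. F = nm (DNot p) \<and> F1 = nm p"
  "next_f F F1 \<in> encoding nm \<phi> \<Longrightarrow> \<exists>p. F = nm (Next p) \<and> F1 = nm p"
  "until_f F F1 F2 \<in> encoding nm \<phi> \<Longrightarrow> \<exists>p q. F = nm (Until p q) \<and> F1 = nm p \<and> F2 = nm q"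
  "always_f F F1 \<in> encoding nm \<phi> \<Longrightarrow> \<exists>p. F = nm (Always p) \<and> F1 = nm p"
  "eventually_f F F1 \<in> encoding nm \<phi> \<Longrightarrow> \<exists>p. F = nm (Eventually p) \<and> F1 = nm p"
  by (induction nm \<phi> rule: encoding.induct; auto)+

lemma no_temporal_atom_in_encoding:
  "occ a t \<notin> encoding nm \<phi>"
  "holds F t \<notin> encoding nm \<phi>"
  "satisfy F t \<notin> encoding nm \<phi>"
  "during F t u \<notin> encoding nm \<phi>"
  by (induction nm \<phi> rule: encoding.induct; auto)+

section \<open>The program of a trajectory and its facts\<close>

locale encoded_trajectory =
  fixes \<alpha> :: "('a, 'f) trajectory"
    and nm :: "('a, 'f) basic_desire \<Rightarrow> ('f, 'n) name"
    and \<phi> :: "('a, 'f) basic_desire"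
  assumes length_states: "length (fst \<alpha>) = traj_length \<alpha> + 1"
    and naming: "naming nm"
begin

abbreviation "len \<equiv> traj_length \<alpha>"
abbreviation "prog \<equiv> facts (Pi_desire nm \<phi>) \<union> Pi_sat len \<union> facts (traj_facts \<alpha>)"
abbreviation "desired \<eta> \<equiv> desire (nm \<eta>) \<in> Pi_desire nm \<phi>"

definition known :: "('a, 'f, 'n) atom set" where
  "known = Pi_desire nm \<phi> \<union> traj_facts \<alpha>"

text \<open>\<open>M\<close> is arbitrary; the answer sets are exactly the fixed points of
  \<open>lm\<close>.\<close>

definition lm :: "('a, 'f, 'n) atom set \<Rightarrow> ('a, 'f, 'n) atom set" where
  "lm M = least_model (reduct prog M)"

lemma inj_nm: "inj nm" and nm_Lit: "nm (Lit l) = LitName l"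
  using naming by (auto simp: naming_def)

lemma nm_eq_iff: "nm p = nm q \<longleftrightarrow> p = q"
  using inj_nm by (simp add: inj_eq)

lemma nm_eq_LitName_iff: "nm p = LitName l \<longleftrightarrow> p = Lit l"
  by (metis nm_Lit nm_eq_iff)

text \<open>The \<open>desire\<close> facts added for all literals do no harm: the encoding of a
  literal consists of that one fact.\<close>

lemma encoding_subset_Pi_desire: "desired \<eta> \<Longrightarrow> encoding nm \<eta> \<subseteq> Pi_desire nm \<phi>"
  using encoding_mono[OF inj_nm] by (fastforce simp: Pi_desire_def nm_eq_iff)

lemma desired_subformulas:
  "desired (Goal f) \<Longrightarrow> desired (of_fformula f)"
  "desired (DAnd p q) \<Longrightarrow> desired p" "desired (DAnd p q) \<Longrightarrow> desired q"
  "desired (DOr p q) \<Longrightarrow> desired p" "desired (DOr p q) \<Longrightarrow> desired q"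
  "desired (DNot p) \<Longrightarrow> desired p"
  "desired (Next p) \<Longrightarrow> desired p"
  "desired (Until p q) \<Longrightarrow> desired p" "desired (Until p q) \<Longrightarrow> desired q"
  "desired (Always p) \<Longrightarrow> desired p"
  "desired (Eventually p) \<Longrightarrow> desired p"
  by (drule encoding_subset_Pi_desire, auto simp: desire_in_encoding subset_iff)+

lemma temporal_atom_notin_known:
  "satisfy F t \<notin> known" "during F t u \<notin> known"
  by (auto simp: known_def Pi_desire_def traj_facts_def no_temporal_atom_in_encoding)

lemma desire_known_iff: "desire F \<in> known \<longleftrightarrow> (\<exists>p. F = nm p \<and> desired p)"
  by (auto simp: known_def Pi_desire_def traj_facts_def dest: encoding_shape)

text \<open>Actions are numbered from 1 and the action numbered \<open>i\<close> occurs at time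
  \<open>i - 1\<close>, so none occurs at time \<open>len\<close>.\<close>

lemma occ_known_iff: "occ a t \<in> known \<longleftrightarrow> t < len \<and> traj_action \<alpha> (t + 1) = a"
proof -
  have "(\<exists>i. a = traj_action \<alpha> i \<and> t = i - 1 \<and> 1 \<le> i \<and> i \<le> len) \<longleftrightarrow>
      t < len \<and> traj_action \<alpha> (t + 1) = a" (is "?l = ?r")
  proof
    assume ?r
    then show ?l by (intro exI[of _ "t + 1"]) auto
  qed auto
  then show ?thesis
    by (auto simp: known_def Pi_desire_def traj_facts_def no_temporal_atom_in_encoding)
qed

lemma holds_known_iff: "holds (LitName l) t \<in> known \<longleftrightarrow> t \<le> len \<and> l \<in> traj_state \<alpha> t"
  by (auto simp: known_def Pi_desire_def traj_facts_def no_temporal_atom_in_encoding)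

text \<open>A name determines its formula, so the structural fact about the name of \<eta> can only
  be the one for the top connective of \<eta>.\<close>

lemma structure_known_iff:
  assumes "desired \<eta>"
  shows
    "goal (nm \<eta>) F1 \<in> known \<longleftrightarrow> (\<exists>p. \<eta> = Goal p \<and> F1 = nm (of_fformula p))"
    "happen (nm \<eta>) a \<in> known \<longleftrightarrow> \<eta> = Occ a"
    "and_f (nm \<eta>) F1 F2 \<in> known \<longleftrightarrow> (\<exists>p q. \<eta> = DAnd p q \<and> F1 = nm p \<and> F2 = nm q)"
    "or_f (nm \<eta>) F1 F2 \<in> known \<longleftrightarrow> (\<exists>p q. \<eta> = DOr p q \<and> F1 = nm p \<and> F2 = nm q)"
    "negation_f (nm \<eta>) F1 \<in> known \<longleftrightarrow> (\<exists>p. \<eta> = DNot p \<and> F1 = nm p)"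
    "next_f (nm \<eta>) F1 \<in> known \<longleftrightarrow> (\<exists>p. \<eta> = Next p \<and> F1 = nm p)"
    "until_f (nm \<eta>) F1 F2 \<in> known \<longleftrightarrow> (\<exists>p q. \<eta> = Until p q \<and> F1 = nm p \<and> F2 = nm q)"
    "always_f (nm \<eta>) F1 \<in> known \<longleftrightarrow> (\<exists>p. \<eta> = Always p \<and> F1 = nm p)"
    "eventually_f (nm \<eta>) F1 \<in> known \<longleftrightarrow> (\<exists>p. \<eta> = Eventually p \<and> F1 = nm p)"
  using encoding_subset_Pi_desire[OF assms]
  by (auto simp: known_def Pi_desire_def traj_facts_def nm_eq_iff dest!: encoding_shape(2-))

section \<open>Completion of the program\<close>

lemma prog_iff: "Rule x bs cs \<in> prog \<longleftrightarrow> x \<in> known \<and> bs = [] \<and> cs = [] \<or> Rule x bs cs \<in> Pi_sat len"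
  by (auto simp: facts_def known_def)

lemma lm_iff:
  "x \<in> lm M \<longleftrightarrow>
     x \<in> known \<or> (\<exists>bs cs. Rule x bs cs \<in> Pi_sat len \<and> set bs \<subseteq> lm M \<and> set cs \<inter> M = {})"
  unfolding lm_def least_model_reduct_iff[of x] prog_iff
  by (simp add: conj_disj_distribR ex_disj_distrib)

lemma rule_head: "Rule x bs cs \<in> Pi_sat len \<Longrightarrow> (\<exists>F t. x = satisfy F t) \<or> (\<exists>F t u. x = during F t u)"
  by (cases rule: Pi_sat.cases) auto

lemma static_in_lm_iff:
  "desire F \<in> lm M \<longleftrightarrow> desire F \<in> known"
  "goal F F1 \<in> lm M \<longleftrightarrow> goal F F1 \<in> known"
  "happen F a \<in> lm M \<longleftrightarrow> happen F a \<in> known"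
  "and_f F F1 F2 \<in> lm M \<longleftrightarrow> and_f F F1 F2 \<in> known"
  "or_f F F1 F2 \<in> lm M \<longleftrightarrow> or_f F F1 F2 \<in> known"
  "negation_f F F1 \<in> lm M \<longleftrightarrow> negation_f F F1 \<in> known"
  "next_f F F1 \<in> lm M \<longleftrightarrow> next_f F F1 \<in> known"
  "until_f F F1 F2 \<in> lm M \<longleftrightarrow> until_f F F1 F2 \<in> known"
  "always_f F F1 \<in> lm M \<longleftrightarrow> always_f F F1 \<in> known"
  "eventually_f F F1 \<in> lm M \<longleftrightarrow> eventually_f F F1 \<in> known"
  "occ a t \<in> lm M \<longleftrightarrow> occ a t \<in> known"
  "holds F t \<in> lm M \<longleftrightarrow> holds F t \<in> known"
  by (subst lm_iff, blast dest: rule_head)+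

text \<open>One disjunct for each kind of structural fact. Only the one for negation consults
  \<open>M\<close>; all other \<open>satisfy\<close> and \<open>during\<close> atoms are looked up
  in \<open>lm M\<close>.\<close>

lemma satisfy_in_lm_iff:
  "satisfy F T \<in> lm M \<longleftrightarrow> T \<le> len \<and> desire F \<in> known \<and>
     ((\<exists>F1. goal F F1 \<in> known \<and> satisfy F1 len \<in> lm M) \<or>
      (\<exists>a. happen F a \<in> known \<and> occ a T \<in> known) \<or>
      (\<exists>l. F = LitName l \<and> holds F T \<in> known) \<or>
      (\<exists>F1 F2. and_f F F1 F2 \<in> known \<and> satisfy F1 T \<in> lm M \<and> satisfy F2 T \<in> lm M) \<or>
      (\<exists>F1 F2. or_f F F1 F2 \<in> known \<and> (satisfy F1 T \<in> lm M \<or> satisfy F2 T \<in> lm M)) \<or>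
      (\<exists>F1. negation_f F F1 \<in> known \<and> satisfy F1 T \<notin> M) \<or>
      (\<exists>F1 F2. until_f F F1 F2 \<in> known \<and>
         (satisfy F2 T \<in> lm M \<or>
          (\<exists>T1. T < T1 \<and> T1 \<le> len \<and> during F1 T (T1 - 1) \<in> lm M \<and> satisfy F2 T1 \<in> lm M))) \<or>
      (\<exists>F1. always_f F F1 \<in> known \<and> during F1 T len \<in> lm M) \<or>
      (\<exists>F1. next_f F F1 \<in> known \<and> satisfy F1 (T + 1) \<in> lm M) \<or>
      (\<exists>F1. eventually_f F F1 \<in> known \<and> (\<exists>T1. T \<le> T1 \<and> T1 \<le> len \<and> satisfy F1 T1 \<in> lm M)))"
  (is "?l \<longleftrightarrow> ?r")
proof
  assume ?l
  then obtain bs cs where r: "Rule (satisfy F T) bs cs \<in> Pi_sat len"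
    and bs: "set bs \<subseteq> lm M" and cs: "set cs \<inter> M = {}"
    by (subst (asm) lm_iff) (use temporal_atom_notin_known in blast)
  from r show ?r
  proof cases
    case 1 then show ?thesis using bs by (simp add: static_in_lm_iff) blast
  next
    case 2 then show ?thesis using bs by (simp add: static_in_lm_iff) blast
  next
    case 3 then show ?thesis using bs by (simp add: static_in_lm_iff)
  next
    case 4 then show ?thesis using bs by (simp add: static_in_lm_iff) blast
  next
    case 5 then show ?thesis using bs by (simp add: static_in_lm_iff) blast
  next
    case 6 then show ?thesis using bs by (simp add: static_in_lm_iff) blast
  next
    case 7 then show ?thesis using bs cs by (simp add: static_in_lm_iff) blast
  next
    case 8 then show ?thesis using bs by (simp add: static_in_lm_iff) blast
  next
    case 9 then show ?thesis using bs by (simp add: static_in_lm_iff) blast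
  next
    case 10 then show ?thesis using bs by (simp add: static_in_lm_iff) blast
  next
    case 11 then show ?thesis using bs by (simp add: static_in_lm_iff) blast
  next
    case 12 then show ?thesis using bs by (simp add: static_in_lm_iff) blast
  qed
next
  have apply_rule: "satisfy F T \<in> lm M"
    if "Rule (satisfy F T) bs cs \<in> Pi_sat len" "\<forall>b \<in> set bs. b \<in> lm M" "\<forall>c \<in> set cs. c \<notin> M" for bs cs
    using that by (subst lm_iff) blast
  \<comment> \<open>The first twelve introduction rules are those with a \<open>satisfy\<close>
    head; each becomes one ready-made implication, with static body atoms replaced by membership in
    \<open>known\<close>.\<close>
  note intros = Pi_sat.intros(1-12)[THEN apply_rule, simplified list.set ball_simps static_in_lm_iff simp_thms]
  assume ?r
  then show ?l
    by - (elim conjE disjE exE; (rule intros; (intro conjI TrueI)?; assumption))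
qed

text \<open>Bounds the times of derivable \<open>satisfy\<close> atoms, which makes the rule for
  \<open>next_f\<close> inert at time \<open>len\<close>.\<close>

lemma satisfy_in_lm_imp_desired: "satisfy F T \<in> lm M \<Longrightarrow> \<exists>p. F = nm p \<and> desired p \<and> T \<le> len"
  by (subst (asm) satisfy_in_lm_iff) (use desire_known_iff in blast)

text \<open>The body atom \<open>desire F\<close> disappears because every derivation of
  \<open>satisfy F T\<close> already requires it.\<close>

lemma during_in_lm_unfold:
  "during F T T1 \<in> lm M \<longleftrightarrow>
     T1 \<le> len \<and> satisfy F T \<in> lm M \<and> (T = T1 \<or> T < T1 \<and> during F (T + 1) T1 \<in> lm M)"
  (is "?l \<longleftrightarrow> ?r")
proof
  assume ?l
  then obtain bs cs where r: "Rule (during F T T1) bs cs \<in> Pi_sat len"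
    and bs: "set bs \<subseteq> lm M"
    by (subst (asm) lm_iff) (use temporal_atom_notin_known in blast)
  from r show ?r
    by (cases rule: Pi_sat.cases) (use bs in auto)
next
  assume r: ?r
  then have d: "desire F \<in> lm M" "T \<le> len"
    using satisfy_in_lm_imp_desired[of F T M] by (auto simp: static_in_lm_iff(1) desire_known_iff)
  have "\<exists>bs. Rule (during F T T1) bs [] \<in> Pi_sat len \<and> set bs \<subseteq> lm M"
  proof (cases "T = T1")
    case True
    then have "Rule (during F T T1) [desire F, satisfy F T] [] \<in> Pi_sat len"
      using d(2) by (auto intro: Pi_sat.intros)
    then show ?thesis
      using d r by (intro exI[of _ "[desire F, satisfy F T]"]) simp
  next
    case False
    then have "Rule (during F T T1) [desire F, satisfy F T, during F (T + 1) T1] [] \<in> Pi_sat len"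
      using d(2) r by (intro Pi_sat.intros) auto
    then show ?thesis
      using False d r by (intro exI[of _ "[desire F, satisfy F T, during F (T + 1) T1]"]) simp
  qed
  then show ?l
    by (subst lm_iff) force
qed

text \<open>Downward induction on \<open>T\<close> from \<open>T1\<close>, since the recursive rule
  peels off the left end of the interval.\<close>

lemma during_in_lm_iff:
  "during F T T1 \<in> lm M \<longleftrightarrow>
     T \<le> T1 \<and> T1 \<le> len \<and> (\<forall>u. T \<le> u \<longrightarrow> u \<le> T1 \<longrightarrow> satisfy F u \<in> lm M)"
proof (cases "T \<le> T1")
  case True
  then show ?thesis
  proof (induction T rule: inc_induct)
    case base
    then show ?case by (subst during_in_lm_unfold) auto
  next
    case (step T)
    have "(\<forall>u. T \<le> u \<longrightarrow> u \<le> T1 \<longrightarrow> satisfy F u \<in> lm M) \<longleftrightarrow>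
        satisfy F T \<in> lm M \<and> (\<forall>u. Suc T \<le> u \<longrightarrow> u \<le> T1 \<longrightarrow> satisfy F u \<in> lm M)"
      using step.hyps by (metis Suc_leD Suc_leI le_neq_implies_less less_imp_le_nat order_refl)
    then show ?case
      using step by (subst during_in_lm_unfold) auto
  qed
next
  case False
  then show ?thesis by (subst during_in_lm_unfold) auto
qed

section \<open>Correctness of least models and of answer sets\<close>

definition correct_for :: "('a, 'f, 'n) atom set \<Rightarrow> ('a, 'f) basic_desire \<Rightarrow> bool" where
  "correct_for M \<eta> \<longleftrightarrow> (\<forall>t \<le> len. satisfy (nm \<eta>) t \<in> M \<longleftrightarrow> sat (traj_from \<alpha> t) \<eta>)"

text \<open>Negated atoms are settled by the assumption on \<open>M\<close>. Positive ones need
  correctness of \<open>lm M\<close> on smaller formulas, supplied by an inner induction on size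
  along which the assumption on \<open>M\<close> is inherited.\<close>

lemma lm_correct_step:
  assumes "desired \<eta>"
    and "\<And>p. desired p \<Longrightarrow> size p < size \<eta> \<Longrightarrow> correct_for M p"
  shows "correct_for (lm M) \<eta>"
  using assms
proof (induction \<eta> rule: measure_induct_rule[of size])
  case (less \<eta>)
  note des = \<open>desired \<eta>\<close>
  have sub: "t \<le> len \<Longrightarrow> satisfy (nm p) t \<in> lm M \<longleftrightarrow> sat (traj_from \<alpha> t) p"
    if "desired p" "size p < size \<eta>" for p t
  proof -
    have "correct_for (lm M) p"
      using less.IH[OF that(2,1)] less.prems(2) that(2) by simp
    then show "t \<le> len \<Longrightarrow> ?thesis" by (simp add: correct_for_def)
  qed
  have subM: "t \<le> len \<Longrightarrow> satisfy (nm p) t \<in> M \<longleftrightarrow> sat (traj_from \<alpha> t) p"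
    if "desired p" "size p < size \<eta>" for p t
    using less.prems(2)[OF that] by (simp add: correct_for_def)
  have known: "desire (nm \<eta>) \<in> known"
    using des by (auto simp: desire_known_iff)
  have "satisfy (nm \<eta>) t \<in> lm M \<longleftrightarrow> sat (traj_from \<alpha> t) \<eta>" if t: "t \<le> len" for t
  proof -
    \<comment> \<open>Once \<eta> is split by its top connective, only the matching disjunct of the
      completion survives.\<close>
    note unfold = satisfy_in_lm_iff[of "nm \<eta>" t M, simplified structure_known_iff[OF des]
      nm_eq_LitName_iff known simp_thms]
    note simps = t traj_length_traj_from traj_from_traj_from
    show ?thesis
    proof (cases \<eta>)
      case (Goal f)
      \<comment> \<open>The last state of the suffix at \<open>t\<close> is the first state of the
        suffix at \<open>len\<close>, so the goal reduces to its fluent formula evaluated at time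
        \<open>len\<close>.\<close>
      have "state_sat (traj_state (traj_from \<alpha> t) (len - t)) f \<longleftrightarrow>
          sat (traj_from \<alpha> len) (of_fformula f :: ('a, 'f) basic_desire)"
        using t length_states by (simp add: sat_of_fformula traj_state_def traj_from_def)
      with unfold show ?thesis
        using sub[of "of_fformula f" len] desired_subformulas(1)[of f] des Goal
        by (simp add: simps size_of_fformula)
    next
      case (Lit l)
      have "traj_state (traj_from \<alpha> t) 0 = traj_state \<alpha> t"
        using t length_states by (simp add: traj_state_def traj_from_def)
      with unfold show ?thesis
        using Lit by (simp add: simps nm_Lit holds_known_iff)
    next
      case (Occ a)
      have "traj_action (traj_from \<alpha> t) 1 = traj_action \<alpha> (t + 1)" if "t < len"
        using that by (simp add: traj_action_def traj_from_def traj_length_def)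
      then have "sat (traj_from \<alpha> t) \<eta> \<longleftrightarrow> t < len \<and> traj_action \<alpha> (t + 1) = a"
        using Occ by (cases "t < len") (auto simp: traj_length_traj_from)
      also have "\<dots> \<longleftrightarrow> satisfy (nm \<eta>) t \<in> lm M"
        using unfold Occ by (simp add: simps occ_known_iff)
      finally show ?thesis by simp
    next
      case (DAnd p q)
      have "desired p" "desired q"
        using des DAnd by (auto intro: desired_subformulas(2,3))
      with unfold show ?thesis
        using DAnd sub[of p t] sub[of q t] by (simp add: simps)
    next
      case (DOr p q)
      have "desired p" "desired q"
        using des DOr by (auto intro: desired_subformulas(4,5))
      with unfold show ?thesis
        using DOr sub[of p t] sub[of q t] by (simp add: simps)
    next
      case (DNot p)
      have "desired p"
        using des DNot by (auto intro: desired_subformulas(6))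
      with unfold show ?thesis
        using DNot subM[of p t] by (simp add: simps)
    next
      case (Next p)
      have dp: "desired p" "size p < size \<eta>"
        using des Next by (auto intro: desired_subformulas(7))
      have "sat (traj_from \<alpha> t) \<eta> \<longleftrightarrow> t < len \<and> sat (traj_from \<alpha> (t + 1)) p"
        using Next by (cases "t < len") (auto simp: simps)
      \<comment> \<open>At \<open>t = len\<close> both sides are false: the suffix has no further
        step, and no \<open>satisfy\<close> atom is derivable at time
        \<open>len + 1\<close>.\<close>
      also have "\<dots> \<longleftrightarrow> satisfy (nm p) (t + 1) \<in> lm M"
        using sub[OF dp, of "t + 1"] satisfy_in_lm_imp_desired[of "nm p" "t + 1" M]
        by (cases "t < len") auto
      also have "\<dots> \<longleftrightarrow> satisfy (nm \<eta>) t \<in> lm M"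
        using unfold Next by (simp add: simps)
      finally show ?thesis by simp
    next
      case (Until p q)
      have dpq: "desired p" "desired q" "size p < size \<eta>" "size q < size \<eta>"
        using des Until by (auto intro: desired_subformulas(8,9))
      \<comment> \<open>Because \<open>t < u\<close>, the truncated subtraction in
        \<open>u - 1\<close> is exact, and the closed interval up to \<open>u - 1\<close> is the
        half-open one below \<open>u\<close>.\<close>
      have before: "during (nm p) t (u - 1) \<in> lm M \<longleftrightarrow>
          (\<forall>v. t \<le> v \<longrightarrow> v < u \<longrightarrow> sat (traj_from \<alpha> v) p)" if "t < u" "u \<le> len" for u
      proof -
        have "v \<le> u - 1 \<longleftrightarrow> v < u" for v
          using that by linarith
        then show ?thesis
          using that sub[OF dpq(1,3)] by (auto simp: during_in_lm_iff)
      qed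
      have "sat (traj_from \<alpha> t) \<eta> \<longleftrightarrow> (\<exists>u. t \<le> u \<and> u \<le> len \<and> sat (traj_from \<alpha> u) q \<and>
          (\<forall>v. t \<le> v \<longrightarrow> v < u \<longrightarrow> sat (traj_from \<alpha> v) p))"
        using Until ex_le_diff_iff[OF t, of "\<lambda>u. sat (traj_from \<alpha> u) q \<and>
          (\<forall>v. t \<le> v \<longrightarrow> v < u \<longrightarrow> sat (traj_from \<alpha> v) p)"]
        by (simp add: simps all_less_shift_iff[of _ "\<lambda>v. sat (traj_from \<alpha> v) p"])
      \<comment> \<open>For \<open>u = t\<close> the condition on earlier moments is vacuous, which
        is the case of the rule without \<open>during\<close>.\<close>
      also have "\<dots> \<longleftrightarrow> sat (traj_from \<alpha> t) q \<or> (\<exists>u. t < u \<and> u \<le> len \<and> sat (traj_from \<alpha> u) q \<and>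
          (\<forall>v. t \<le> v \<longrightarrow> v < u \<longrightarrow> sat (traj_from \<alpha> v) p))"
        using t by (subst ex_le_split_first) auto
      also have "\<dots> \<longleftrightarrow> satisfy (nm q) t \<in> lm M \<or> (\<exists>u. t < u \<and> u \<le> len \<and>
          during (nm p) t (u - 1) \<in> lm M \<and> satisfy (nm q) u \<in> lm M)"
        using sub[OF dpq(2,4)] before t by (simp cong: conj_cong) blast
      also have "\<dots> \<longleftrightarrow> satisfy (nm \<eta>) t \<in> lm M"
        using unfold Until by (simp add: simps)
      finally show ?thesis by simp
    next
      case (Always p)
      have dp: "desired p" "size p < size \<eta>"
        using des Always by (auto intro: desired_subformulas(10))
      have "sat (traj_from \<alpha> t) \<eta> \<longleftrightarrow> (\<forall>u. t \<le> u \<longrightarrow> u \<le> len \<longrightarrow> sat (traj_from \<alpha> u) p)"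
        using Always all_le_diff_iff[OF t, of "\<lambda>u. sat (traj_from \<alpha> u) p"] by (simp add: simps)
      also have "\<dots> \<longleftrightarrow> during (nm p) t len \<in> lm M"
        using sub[OF dp] t by (simp add: during_in_lm_iff)
      also have "\<dots> \<longleftrightarrow> satisfy (nm \<eta>) t \<in> lm M"
        using unfold Always by (simp add: simps)
      finally show ?thesis by simp
    next
      case (Eventually p)
      have dp: "desired p" "size p < size \<eta>"
        using des Eventually by (auto intro: desired_subformulas(11))
      have "sat (traj_from \<alpha> t) \<eta> \<longleftrightarrow> (\<exists>u. t \<le> u \<and> u \<le> len \<and> sat (traj_from \<alpha> u) p)"
        using Eventually ex_le_diff_iff[OF t, of "\<lambda>u. sat (traj_from \<alpha> u) p"] by (simp add: simps)
      also have "\<dots> \<longleftrightarrow> (\<exists>u. t \<le> u \<and> u \<le> len \<and> satisfy (nm p) u \<in> lm M)"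
        using sub[OF dp] by (simp cong: conj_cong)
      also have "\<dots> \<longleftrightarrow> satisfy (nm \<eta>) t \<in> lm M"
        using unfold Eventually by (simp add: simps)
      finally show ?thesis by simp
    qed
  qed
  then show ?case by (simp add: correct_for_def)
qed

text \<open>An answer set satisfies \<open>lm M = M\<close>, so the preceding lemma becomes the step
  of a strong induction on size.\<close>

lemma answer_set_correct:
  assumes "answer_set prog M" "desired \<eta>"
  shows "correct_for M \<eta>"
  using assms(2)
proof (induction \<eta> rule: measure_induct_rule[of size])
  case (less \<eta>)
  then have "correct_for (lm M) \<eta>"
    by (intro lm_correct_step)
  moreover have "lm M = M"
    using assms(1) by (simp add: answer_set_def lm_def)
  ultimately show ?case by simp
qed

section \<open>Existence of an answer set and entailment\<close>

lemma reduct_cong: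
  assumes "\<And>F t. satisfy F t \<in> M \<longleftrightarrow> satisfy F t \<in> N"
  shows "reduct prog M = reduct prog N"
proof -
  have "set (neg_body r) \<inter> M = {} \<longleftrightarrow> set (neg_body r) \<inter> N = {}" if "r \<in> prog" for r
  proof -
    \<comment> \<open>Only the rule for \<open>negation_f\<close> uses negation as failure, and it
      negates a single \<open>satisfy\<close> atom.\<close>
    have "neg_body r = [] \<or> (\<exists>F t. neg_body r = [satisfy F t])"
      using that by (auto simp: facts_def elim: Pi_sat.cases)
    then show ?thesis using assms by auto
  qed
  then show ?thesis unfolding reduct_def by blast
qed

lemma answer_set_exists: "\<exists>M. answer_set prog M"
proof -
  \<comment> \<open>\<open>M\<close> lacks the facts and the \<open>during\<close> atoms, so it only
    serves as a guess. Since \<open>lm M\<close> has the same \<open>satisfy\<close> atoms, both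
    give the same reduct, and \<open>lm M\<close> is the answer set.\<close>
  define M :: "('a, 'f, 'n) atom set"
    where "M = {satisfy (nm p) t | p t. desired p \<and> t \<le> len \<and> sat (traj_from \<alpha> t) p}"
  have M: "correct_for M p" if "desired p" for p
    using that by (auto simp: correct_for_def M_def nm_eq_iff)
  have lmM: "correct_for (lm M) p" if "desired p" for p
    using that M by (rule lm_correct_step)
  have "satisfy F t \<in> M \<longleftrightarrow> satisfy F t \<in> lm M" for F t
  proof
    assume "satisfy F t \<in> M"
    then show "satisfy F t \<in> lm M"
      using lmM by (auto simp: M_def correct_for_def)
  next
    assume *: "satisfy F t \<in> lm M"
    then obtain p where "F = nm p" "desired p" "t \<le> len"
      using satisfy_in_lm_imp_desired by blast
    then show "satisfy F t \<in> M"
      using * M lmM by (auto simp: correct_for_def)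
  qed
  then have "reduct prog M = reduct prog (lm M)"
    by (rule reduct_cong)
  then show ?thesis
    unfolding answer_set_def lm_def by metis
qed

text \<open>Truth on the suffix puts the atom into every answer set; conversely, an entailed atom
  lies in the answer set known to exist, which is correct.\<close>

lemma entails_satisfy_iff:
  assumes "desired \<eta>" "t \<le> len"
  shows "entails prog (satisfy (nm \<eta>) t) \<longleftrightarrow> sat (traj_from \<alpha> t) \<eta>"
  using answer_set_correct[OF _ assms(1)] answer_set_exists assms(2)
  unfolding entails_def correct_for_def by blast

end

theorem theorem2:
  fixes D :: "('a, 'f) domain_prop set"
    and I :: "'f init_prop set"
    and G :: "'f fformula"
    and \<alpha> :: "('a, 'f) trajectory"
    and \<phi> \<eta> :: "('a, 'f) basic_desire"
    and nm :: "('a, 'f) basic_desire \<Rightarrow> ('f, 'n) name"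
    and len t :: nat
  assumes "planning_problem (D, I, G)"
    and "is_trajectory D \<alpha>"
    and "traj_length \<alpha> = len"
    and "naming nm"
    and "t \<le> len"
    and "desire (nm \<eta>) \<in> Pi_desire nm \<phi>"
  shows "sat (traj_from \<alpha> t) \<eta> \<longleftrightarrow>
         entails (facts (Pi_desire nm \<phi>) \<union> Pi_sat len \<union> facts (traj_facts \<alpha>)) (satisfy (nm \<eta>) t)"
proof -
  \<comment> \<open>Inside the locale the bound on time is the length of the trajectory, which the
    third assumption equates with \<open>len\<close>.\<close>
  interpret encoded_trajectory \<alpha> nm \<phi>
    using assms(2,4) by unfold_locales (auto simp: is_trajectory_def)
  show ?thesis
    using entails_satisfy_iff[OF assms(6)] assms(3,5) by simp
qed

end
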